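(* For every complex number $s$ with $\operatorname{Re}(s)>1$, $$\left(\sum_{n=1}^{\infty}\frac{\mu_3(n)}{n^{s}}\right)^{-1}=\sum_{\substack{n=p_1^{m_1}\cdots p_k^{m_k}\\ m_j\not\equiv 2,5 \ (\mathrm{mod}\ 6)}}\frac{(-1)^{m_*(n)}}{n^{s}},$$ where the sum on the right is over all positive integers $n$ such that every exponent $m_j$ in the prime factorization $n=p_1^{m_1}\cdots p_k^{m_k}$ satisfies $m_j\not\equiv 2$ and $m_j\not\equiv 5 \pmod 6$ (the integer $n=1$ is included).
   Context: The Möbius function of rank $3$ is the arithmetic function $\mu_3:\{1,2,3,\dots\}\to\{-1,0,1\}$ defined by $\mu_3(1)=1$; $\mu_3(n)=(-1)^{m_1+\cdots+m_k}$ if $n=p_1^{m_1}\cdots p_k^{m_k}$ (distinct primes $p_j$, all $m_j\ge 1$) with all $m_j<3$; and $\mu_3(n)=0$ if $p^3\mid n$ for some prime $p$. For $n=p_1^{m_1}\cdots p_k^{m_k}$ with distinct primes $p_j$ and all $m_j\ge1$, $m_*(n)=|\{j : m_j\equiv 3 \text{ or } 4 \pmod 6\}|$; in particular $m_*(1)=0$. *)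

theory Defs
  imports "HOL-Analysis.Analysis" "HOL-Computational_Algebra.Primes"
begin

text \<open>
  Arithmetic functions are defined on \<^typ>\<open>nat\<close>, although only their values at positive
  arguments matter.  The primes \<open>p\<^sub>j\<close> in the factorization of \<open>n\<close> are the elements of
  \<open>prime_factors n\<close>, and the exponent of \<open>p\<close> is \<open>multiplicity p n\<close>.
\<close>

text \<open>
  The case \<open>n = 1\<close> needs no clause of its own: the sum of exponents is then empty.
\<close>

definition mobius3 :: "nat \<Rightarrow> int" where
  "mobius3 n =
     (if \<exists>p. prime p \<and> p ^ 3 dvd n then 0
      else (-1) ^ (\<Sum>p\<in>prime_factors n. multiplicity p n))"

definition m_star :: "nat \<Rightarrow> nat" where
  "m_star n =
     card {p \<in> prime_factors n. multiplicity p n mod 6 = 3 \<or> multiplicity p n mod 6 = 4}"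

definition admissible :: "nat set" where
  "admissible =
     {n. n > 0 \<and> (\<forall>p\<in>prime_factors n. multiplicity p n mod 6 \<noteq> 2 \<and> multiplicity p n mod 6 \<noteq> 5)}"

end

theory Submission
  imports Defs "HOL-Computational_Algebra.Formal_Power_Series"
begin

text \<open>
  Both arithmetic functions in the theorem are multiplicative, and their values at a prime power
  \<open>p ^ k\<close> depend only on \<open>k\<close>.  Such a function is determined by its Bell series, the power series
  whose \<open>k\<close>-th coefficient is the value at \<open>p ^ k\<close>.  The Bell series of \<open>mobius3\<close> is
  \<open>1 - X + X\<^sup>2\<close>, and the right-hand side has the Bell series

  \<open>(1 - X + X\<^sup>2)\<^sup>-\<^sup>1 = (1 + X) (1 + X ^ 3)\<^sup>-\<^sup>1 = 1 + X - X ^ 3 - X ^ 4 + X ^ 6 + X ^ 7 - \<dots>\<close>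

  whose coefficients have period 6: they vanish at exponents \<open>2, 5\<close>, are \<open>-1\<close> at \<open>3, 4\<close>, and
  are \<open>1\<close> at \<open>0, 1\<close>.  This is where both the congruences on the exponents and \<open>m_star\<close>
  come from.

  If two Bell series are inverse to each other, then so are the two arithmetic functions under
  Dirichlet convolution (\<open>dirichlet_convolution_from_bell_series\<close>): splitting off a single prime
  \<open>p\<close> from \<open>n > 1\<close> exhibits the convolution at \<open>n\<close> as a multiple of a coefficient of positive
  index in the product of the Bell series, which is \<open>0\<close>.  Since both functions are bounded, their
  Dirichlet series converge absolutely for \<open>Re s > 1\<close>, so that the product of the two series is
  the Dirichlet series of the convolution (\<open>dirichlet_series_mult\<close>), which is \<open>1\<close>.  A product
  equal to \<open>1\<close> gives the nonvanishing and the formula for the inverse at once.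
\<close>

section \<open>Multiplicative functions with a common Bell series at all primes\<close>

definition from_bell_series :: "'a::comm_ring_1 fps \<Rightarrow> nat \<Rightarrow> 'a" where
  "from_bell_series f n = (\<Prod>p\<in>prime_factors n. fps_nth f (multiplicity p n))"

lemma from_bell_series_1 [simp]: "from_bell_series f (Suc 0) = 1"
  by (simp add: from_bell_series_def)

lemma multiplicity_prime_power_times:
  fixes p :: nat
  assumes "prime p" "\<not> p dvd m" "prime q"
  shows "multiplicity q (p ^ k * m) = (if q = p then k else multiplicity q m)"
proof -
  have "m \<noteq> 0" "p \<noteq> 0" using assms by (auto intro: Nat.gr0I)
  hence "multiplicity q (p ^ k * m) = k * multiplicity q p + multiplicity q m"
    using assms by (simp add: prime_elem_multiplicity_mult_distrib prime_elem_multiplicity_power_distrib)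
  thus ?thesis
    using assms by (auto simp: prime_multiplicity_other not_dvd_imp_multiplicity_0)
qed

text \<open>
  The normalization \<open>f $ 0 = 1\<close> is what allows \<open>k = 0\<close>, where \<open>p\<close> is no prime factor of the
  argument.
\<close>

lemma from_bell_series_prime_power_times:
  assumes "fps_nth f 0 = 1" "prime p" "\<not> p dvd m"
  shows "from_bell_series f (p ^ k * m) = fps_nth f k * from_bell_series f m"
proof (cases "k = 0")
  case False
  have "m \<noteq> 0" "p \<noteq> 0" using assms by (auto intro: Nat.gr0I)
  have pf: "prime_factors (p ^ k * m) = insert p (prime_factors m)"
    using False \<open>m \<noteq> 0\<close> \<open>p \<noteq> 0\<close> assms
    by (auto simp: prime_factors_multiplicity multiplicity_prime_power_times split: if_splits)
  have "p \<notin> prime_factors m" using assms by auto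
  moreover have "(\<Prod>q\<in>prime_factors m. fps_nth f (multiplicity q (p ^ k * m)))
      = (\<Prod>q\<in>prime_factors m. fps_nth f (multiplicity q m))"
    using assms by (intro prod.cong refl)
      (auto simp: multiplicity_prime_power_times in_prime_factors_imp_prime)
  moreover have "multiplicity p (p ^ k * m) = k"
    using assms by (simp add: multiplicity_prime_power_times)
  ultimately show ?thesis
    unfolding from_bell_series_def pf by simp
qed (use assms in simp)

text \<open>
  The divisors of \<open>p ^ k * m\<close> are the products \<open>p ^ j * e\<close>, and \<open>j\<close> is recovered from such a product
  as its multiplicity at \<open>p\<close>.
\<close>

lemma sum_divisors_prime_power_times:
  fixes p :: nat
  assumes "prime p" "\<not> p dvd m"
  shows "(\<Sum>d | d dvd p ^ k * m. F d) = (\<Sum>j\<le>k. \<Sum>e | e dvd m. F (p ^ j * e))"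
proof -
  have m: "m > 0" and p: "p > 0" using assms by (auto intro: Nat.gr0I)
  have "(\<Sum>j\<le>k. \<Sum>e | e dvd m. F (p ^ j * e))
      = (\<Sum>(j, e)\<in>{..k} \<times> {e. e dvd m}. F (p ^ j * e))"
    using m by (simp add: sum.cartesian_product)
  also have "\<dots> = (\<Sum>d | d dvd p ^ k * m. F d)"
  proof (rule sum.reindex_bij_witness[where
        i = "\<lambda>d. (multiplicity p d, d div p ^ multiplicity p d)" and j = "\<lambda>(j, e). p ^ j * e"])
    fix d assume "d \<in> {d. d dvd p ^ k * m}"
    hence d: "d dvd p ^ k * m" by simp
    define j e where "j = multiplicity p d" and "e = d div p ^ multiplicity p d"
    have d_eq: "d = p ^ j * e" by (simp add: j_def e_def multiplicity_dvd)
    have "d \<noteq> 0" using d m p by (auto intro: Nat.gr0I)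
    hence e: "\<not> p dvd e" unfolding e_def
      using assms by (intro multiplicity_decompose) auto
    have "j \<le> multiplicity p (p ^ k * m)"
      unfolding j_def using d m p by (intro dvd_imp_multiplicity_le) auto
    hence "j \<le> k" using assms by (simp add: multiplicity_prime_power_times)
    moreover have "coprime e (p ^ k)"
      using prime_imp_coprime[OF assms(1) e] by (simp add: coprime_commute)
    hence "e dvd m" using d d_eq by (metis coprime_dvd_mult_right_iff dvd_mult_right)
    ultimately show "(multiplicity p d, d div p ^ multiplicity p d) \<in> {..k} \<times> {e. e dvd m}"
      by (simp add: j_def e_def)
    show "(case (multiplicity p d, d div p ^ multiplicity p d) of (j, e) \<Rightarrow> p ^ j * e) = d"
      using d_eq by (simp add: j_def e_def)
  next
    fix x assume "x \<in> {..k} \<times> {e. e dvd m}"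
    then obtain j e where x: "x = (j, e)" "j \<le> k" "e dvd m" by auto
    hence "multiplicity p (p ^ j * e) = j"
      using assms by (subst multiplicity_prime_power_times) auto
    thus "(multiplicity p (case x of (j, e) \<Rightarrow> p ^ j * e),
        (case x of (j, e) \<Rightarrow> p ^ j * e) div p ^ multiplicity p (case x of (j, e) \<Rightarrow> p ^ j * e)) = x"
      using x p by simp
    show "(case x of (j, e) \<Rightarrow> p ^ j * e) \<in> {d. d dvd p ^ k * m}"
      using x by (auto intro: mult_dvd_mono le_imp_power_dvd)
  qed auto
  finally show ?thesis ..
qed

text \<open>
  Write \<open>n = p ^ k * m\<close> with a prime \<open>p\<close> dividing \<open>n\<close> and not dividing \<open>m\<close>.  The convolution at
  \<open>n\<close> then factors as the \<open>k\<close>-th coefficient of \<open>f * g\<close> times the convolution at \<open>m\<close>, and already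
  the first factor vanishes.
\<close>

lemma dirichlet_convolution_from_bell_series:
  assumes fg: "f * g = 1" and f0: "fps_nth f 0 = 1" and n: "n > 0"
  shows "(\<Sum>d | d dvd n. from_bell_series f d * from_bell_series g (n div d))
           = (if n = 1 then 1 else 0)"
proof (cases "n = 1")
  case False
  have g0: "fps_nth g 0 = 1"
    using arg_cong[OF fg, of "\<lambda>h. fps_nth h 0"] f0 by simp
  obtain p where p: "prime p" "p dvd n" using False prime_factor_nat by blast
  define k where "k = multiplicity p n"
  have "\<not> is_unit p" using p by auto
  obtain m where m: "n = p ^ k * m" "\<not> p dvd m"
    using multiplicity_decompose'[of n p] n \<open>\<not> is_unit p\<close> unfolding k_def by auto
  have "k > 0"
    using p n \<open>\<not> is_unit p\<close> by (simp add: k_def prime_multiplicity_gt_zero_iff)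
  have "p > 0" using p by (simp add: prime_gt_0_nat)
  have "(\<Sum>d | d dvd n. from_bell_series f d * from_bell_series g (n div d))
      = (\<Sum>j\<le>k. \<Sum>e | e dvd m.
           from_bell_series f (p ^ j * e) * from_bell_series g (n div (p ^ j * e)))"
    unfolding m(1) using p m by (intro sum_divisors_prime_power_times)
  also have "\<dots> = (\<Sum>j\<le>k. \<Sum>e | e dvd m. (fps_nth f j * fps_nth g (k - j))
           * (from_bell_series f e * from_bell_series g (m div e)))"
  proof (intro sum.cong refl)
    fix j e assume "j \<in> {..k}" "e \<in> {e. e dvd m}"
    then obtain h where j: "j \<le> k" and h: "m = e * h" by (auto elim: dvdE)
    have "\<not> p dvd e" "\<not> p dvd h" "e > 0" using m h by (auto intro: Nat.gr0I)
    have "n = (p ^ j * e) * (p ^ (k - j) * h)"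
      using j unfolding m(1) h by (simp add: power_add[symmetric] mult_ac flip: mult.assoc)
    hence "n div (p ^ j * e) = p ^ (k - j) * h"
      using \<open>p > 0\<close> \<open>e > 0\<close> by simp
    moreover have "m div e = h" using h \<open>e > 0\<close> by simp
    moreover have "from_bell_series f (p ^ j * e) = fps_nth f j * from_bell_series f e"
      using f0 p \<open>\<not> p dvd e\<close> by (intro from_bell_series_prime_power_times) auto
    moreover have "from_bell_series g (p ^ (k - j) * h) = fps_nth g (k - j) * from_bell_series g h"
      using g0 p \<open>\<not> p dvd h\<close> by (intro from_bell_series_prime_power_times) auto
    ultimately show "from_bell_series f (p ^ j * e) * from_bell_series g (n div (p ^ j * e))
        = (fps_nth f j * fps_nth g (k - j)) * (from_bell_series f e * from_bell_series g (m div e))"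
      by (simp only: mult_ac)
  qed
  also have "\<dots> = (\<Sum>j\<le>k. fps_nth f j * fps_nth g (k - j))
      * (\<Sum>e | e dvd m. from_bell_series f e * from_bell_series g (m div e))"
    by (simp add: sum_product)
  also have "(\<Sum>j\<le>k. fps_nth f j * fps_nth g (k - j)) = fps_nth (f * g) k"
    by (simp add: fps_mult_nth atLeast0AtMost)
  also have "\<dots> = 0" using \<open>k > 0\<close> by (simp add: fg)
  finally show ?thesis using False by simp
qed simp

section \<open>Products of absolutely convergent Dirichlet series\<close>

lemma dirichlet_series_abs_summable:
  fixes u :: "nat \<Rightarrow> complex"
  assumes "Re s > 1" "\<And>n. norm (u n) \<le> 1"
  shows "(\<lambda>n. norm (u n / of_nat n powr s)) summable_on A"
proof -
  have "summable (\<lambda>n. of_nat n powr (- Re s) :: real)"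
    using assms by (subst summable_real_powr_iff) simp
  hence "(\<lambda>n. of_nat n powr (- Re s) :: real) summable_on UNIV"
    by (intro norm_summable_imp_summable_on) simp
  hence "(\<lambda>n. of_nat n powr (- Re s) :: real) summable_on A"
    by (rule summable_on_subset_banach) simp
  thus ?thesis
  proof (rule summable_on_comparison_test)
    fix n
    have "norm (u n / of_nat n powr s) = norm (u n) * real n powr (- Re s)"
      by (simp add: norm_divide norm_powr_real_powr powr_minus divide_simps)
    also have "\<dots> \<le> 1 * real n powr (- Re s)"
      using assms by (intro mult_right_mono) auto
    finally show "norm (u n / of_nat n powr s) \<le> real n powr (- Re s)" by simp
  qed auto
qed

lemma abs_summable_on_Times:
  fixes x :: "'a \<Rightarrow> complex" and y :: "'b \<Rightarrow> complex"
  assumes "(\<lambda>i. norm (x i)) summable_on A" "(\<lambda>j. norm (y j)) summable_on B"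
  shows "(\<lambda>z. norm (case z of (i, j) \<Rightarrow> x i * y j)) summable_on (A \<times> B)"
  unfolding Infinite_Sum.abs_summable_on_Sigma_iff using assms
  by (auto simp: norm_mult infsum_cmult_right' infsum_nonneg
      intro!: summable_on_cmult_right summable_on_cmult_left)

text \<open>
  The double series over pairs \<open>(d, e)\<close> converges absolutely, so it may be summed by grouping the
  pairs with a given product \<open>n = d * e\<close>.
\<close>

lemma dirichlet_series_mult:
  fixes u v :: "nat \<Rightarrow> complex"
  assumes s: "Re s > 1" and u: "\<And>n. norm (u n) \<le> 1" and v: "\<And>n. norm (v n) \<le> 1"
  shows "(\<Sum>\<^sub>\<infinity>n\<in>{0<..}. u n / of_nat n powr s) * (\<Sum>\<^sub>\<infinity>n\<in>{0<..}. v n / of_nat n powr s)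
       = (\<Sum>\<^sub>\<infinity>n\<in>{0<..}. (\<Sum>d | d dvd n. u d * v (n div d)) / of_nat n powr s)"
proof -
  let ?U = "\<lambda>n. u n / of_nat n powr s" and ?V = "\<lambda>n. v n / of_nat n powr s"
  let ?N = "{0<..} :: nat set" and ?S = "SIGMA n:{0<..}. {d::nat. d dvd n}"
  have U: "(\<lambda>n. norm (?U n)) summable_on ?N" and V: "(\<lambda>n. norm (?V n)) summable_on ?N"
    using dirichlet_series_abs_summable[OF s] u v by auto
  have "(\<lambda>x. norm (case x of (d, e) \<Rightarrow> ?U d * ?V e)) summable_on (?N \<times> ?N)"
    using U V by (rule abs_summable_on_Times)
  hence sm: "(\<lambda>(d, e). ?U d * ?V e) summable_on (?N \<times> ?N)"
    by (rule abs_summable_summable)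
  have bij: "bij_betw (\<lambda>(n, d). (d, n div d)) ?S (?N \<times> ?N)"
    by (rule bij_betwI[where g = "\<lambda>(d, e). (d * e, d)"]) (auto intro: Nat.gr0I elim!: dvdE)
  have cong: "(case case x of (n, d) \<Rightarrow> (d, n div d) of (d, e) \<Rightarrow> ?U d * ?V e)
      = (case x of (n, d) \<Rightarrow> u d * v (n div d) / of_nat n powr s)" if "x \<in> ?S" for x
  proof -
    obtain d e where x: "x = (d * e, d)" "d > 0"
      using \<open>x \<in> ?S\<close> by (auto elim!: dvdE)
    have "of_nat (d * e) powr s = of_nat d powr s * of_nat e powr s"
      by (simp add: powr_times_real)
    thus ?thesis using x by simp
  qed
  have sm': "(\<lambda>(n, d). u d * v (n div d) / of_nat n powr s) summable_on ?S"
    using summable_on_reindex_bij_betw[OF bij, THEN iffD2, OF sm]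
    by (rule summable_on_cong[THEN iffD1, rotated]) (rule cong)
  have "infsum ?U ?N * infsum ?V ?N = (\<Sum>\<^sub>\<infinity>d\<in>?N. \<Sum>\<^sub>\<infinity>e\<in>?N. ?U d * ?V e)"
    by (simp only: infsum_cmult_right' infsum_cmult_left')
  also have "\<dots> = (\<Sum>\<^sub>\<infinity>(d, e)\<in>?N \<times> ?N. ?U d * ?V e)"
    using infsum_Sigma'_banach[OF sm] by simp
  also have "\<dots> = (\<Sum>\<^sub>\<infinity>(n, d)\<in>?S. u d * v (n div d) / of_nat n powr s)"
    by (subst infsum_reindex_bij_betw[OF bij, symmetric]) (rule infsum_cong, rule cong)
  also have "\<dots> = (\<Sum>\<^sub>\<infinity>n\<in>?N. \<Sum>\<^sub>\<infinity>d\<in>{d. d dvd n}. u d * v (n div d) / of_nat n powr s)"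
    using infsum_Sigma'_banach[OF sm'] by simp
  also have "\<dots> = (\<Sum>\<^sub>\<infinity>n\<in>?N. (\<Sum>d | d dvd n. u d * v (n div d)) / of_nat n powr s)"
    by (intro infsum_cong) (simp add: sum_divide_distrib)
  finally show ?thesis .
qed

section \<open>The Bell series of the two arithmetic functions\<close>

definition mobius3_bell :: "int fps" where
  "mobius3_bell = 1 - fps_X + fps_X ^ 2"

definition mobius3_inverse_bell :: "int fps" where
  "mobius3_inverse_bell = Abs_fps (\<lambda>k. if k mod 6 \<in> {0, 1} then 1
     else if k mod 6 \<in> {3, 4} then -1 else 0)"

text \<open>
  Apart from the initial coefficients, this is the recurrence \<open>c k - c (k - 1) + c (k - 2) = 0\<close> for
  \<open>k \<ge> 2\<close>; the sequence \<open>c\<close> has period 6, so six residues decide it.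
\<close>

lemma mobius3_bell_mult_inverse: "mobius3_bell * mobius3_inverse_bell = 1"
proof (rule fps_ext)
  fix k :: nat
  let ?c = "fps_nth mobius3_inverse_bell"
  have *: "fps_nth (mobius3_bell * mobius3_inverse_bell) k
      = ?c k - (if k = 0 then 0 else ?c (k - 1)) + (if k < 2 then 0 else ?c (k - 2))"
    by (simp add: mobius3_bell_def algebra_simps fps_X_power_mult_right_nth)
  consider "k = 0" | "k = 1" | j where "k = j + 2"
    by (metis One_nat_def Suc_1 add_2_eq_Suc' not0_implies_Suc)
  thus "fps_nth (mobius3_bell * mobius3_inverse_bell) k = fps_nth 1 k"
  proof cases
    case 3
    have "j mod 6 < 6" by simp
    hence "j mod 6 \<in> {0, 1, 2, 3, 4, 5}" by auto
    hence "?c (Suc (Suc j)) - ?c (Suc j) + ?c j = 0"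
      by (auto simp: mobius3_inverse_bell_def mod_Suc)
    thus ?thesis unfolding * by (simp add: 3)
  qed (unfold *, simp_all add: mobius3_inverse_bell_def)
qed

lemma mobius3_eq_from_bell_series:
  assumes "n > 0"
  shows "mobius3 n = from_bell_series mobius3_bell n"
proof (cases "\<exists>p. prime p \<and> p ^ 3 dvd n")
  case True
  then obtain p where p: "prime p" "p ^ 3 dvd n" by blast
  hence "multiplicity p n \<ge> 3" using assms by (intro multiplicity_geI) auto
  hence "fps_nth mobius3_bell (multiplicity p n) = 0"
    by (simp add: mobius3_bell_def fps_X_power_iff)
  moreover have "p \<in> prime_factors n"
    using p assms by (auto simp: prime_factors_dvd intro: dvd_trans[of p "p ^ 3"])
  ultimately have "from_bell_series mobius3_bell n = 0"
    unfolding from_bell_series_def by (intro prod_zero) auto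
  with True show ?thesis by (simp add: mobius3_def)
next
  case False
  have "fps_nth mobius3_bell (multiplicity p n) = (-1) ^ multiplicity p n"
    if "p \<in> prime_factors n" for p
  proof -
    have "\<not> p ^ 3 dvd n" using False that by auto
    hence "multiplicity p n < 3" using multiplicity_dvd' by (metis not_less)
    hence "multiplicity p n \<in> {0, 1, 2}" by auto
    thus ?thesis by (auto simp: mobius3_bell_def)
  qed
  thus ?thesis using False
    by (simp add: mobius3_def from_bell_series_def power_sum)
qed

lemma admissible_sign_eq_from_bell_series:
  assumes "n > 0"
  shows "(if n \<in> admissible then (-1) ^ m_star n else 0) = from_bell_series mobius3_inverse_bell n"
proof (cases "n \<in> admissible")
  case False
  then obtain p where p: "p \<in> prime_factors n"
      "multiplicity p n mod 6 = 2 \<or> multiplicity p n mod 6 = 5"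
    using assms by (auto simp: admissible_def)
  hence "fps_nth mobius3_inverse_bell (multiplicity p n) = 0"
    by (auto simp: mobius3_inverse_bell_def)
  hence "from_bell_series mobius3_inverse_bell n = 0"
    unfolding from_bell_series_def using p by (intro prod_zero) auto
  with False show ?thesis by simp
next
  case True
  define B where "B = {p \<in> prime_factors n.
    multiplicity p n mod 6 = 3 \<or> multiplicity p n mod 6 = 4}"
  have "fps_nth mobius3_inverse_bell (multiplicity p n) = (if p \<in> B then -1 else 1)"
    if "p \<in> prime_factors n" for p
  proof -
    have "multiplicity p n mod 6 < 6" by simp
    hence "multiplicity p n mod 6 \<in> {0, 1, 2, 3, 4, 5}" by auto
    thus ?thesis using True that
      by (auto simp: mobius3_inverse_bell_def B_def admissible_def)
  qed
  hence "from_bell_series mobius3_inverse_bell n = (\<Prod>p\<in>prime_factors n. if p \<in> B then -1 else 1)"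
    by (simp add: from_bell_series_def)
  also have "\<dots> = (\<Prod>p\<in>prime_factors n \<inter> B. -1)"
    by (rule prod.inter_restrict[symmetric]) simp
  also have "prime_factors n \<inter> B = B" by (auto simp: B_def)
  finally show ?thesis using True by (simp add: m_star_def B_def)
qed

section \<open>The reciprocal of the Dirichlet series\<close>

theorem theorem1p3:
  fixes s :: complex
  assumes "Re s > 1"
  shows "summable (\<lambda>n. of_int (mobius3 (Suc n)) / of_nat (Suc n) powr s)
    \<and> (\<Sum>n. of_int (mobius3 (Suc n)) / of_nat (Suc n) powr s) \<noteq> 0
    \<and> (\<lambda>n. (-1) ^ m_star n / of_nat n powr s) summable_on admissible
    \<and> inverse (\<Sum>n. of_int (mobius3 (Suc n)) / of_nat (Suc n) powr s)
        = (\<Sum>\<^sub>\<infinity>n\<in>admissible. (-1) ^ m_star n / of_nat n powr s)"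
proof -
  \<comment> \<open>Extending the signs by \<open>0\<close> outside \<open>admissible\<close> turns the right-hand side into a
      Dirichlet series over all positive integers.\<close>
  define u v :: "nat \<Rightarrow> complex" where "u n = of_int (mobius3 n)"
    and "v n = (if n \<in> admissible then (-1) ^ m_star n else 0)" for n
  have u1: "norm (u n) \<le> 1" and v1: "norm (v n) \<le> 1" for n
    by (auto simp: u_def v_def mobius3_def norm_power)
  let ?D = "\<lambda>w. \<Sum>\<^sub>\<infinity>n\<in>{0<..}. w n / of_nat n powr s"

  have conv: "(\<Sum>d | d dvd n. u d * v (n div d)) = (if n = 1 then 1 else 0)" if n: "n > 0" for n
  proof -
    have "(\<Sum>d | d dvd n. u d * v (n div d)) = (\<Sum>d | d dvd n.
        of_int (from_bell_series mobius3_bell d * from_bell_series mobius3_inverse_bell (n div d)))"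
    proof (intro sum.cong refl)
      fix d assume "d \<in> {d. d dvd n}"
      hence d: "d > 0" "n div d > 0" using n by (auto elim!: dvdE intro: Nat.gr0I)
      have "v (n div d) = of_int (if n div d \<in> admissible then (-1) ^ m_star (n div d) else 0)"
        by (simp add: v_def)
      thus "u d * v (n div d) = of_int (from_bell_series mobius3_bell d
          * from_bell_series mobius3_inverse_bell (n div d))"
        using d by (simp only: u_def mobius3_eq_from_bell_series
            admissible_sign_eq_from_bell_series of_int_mult)
    qed
    also have "\<dots> = of_int (if n = 1 then 1 else 0)"
      unfolding of_int_sum[symmetric] using n
      by (subst dirichlet_convolution_from_bell_series[OF mobius3_bell_mult_inverse])
        (auto simp: mobius3_bell_def)
    finally show ?thesis by simp
  qed
  have "?D u * ?D v = (\<Sum>\<^sub>\<infinity>n\<in>{0<..}. (\<Sum>d | d dvd n. u d * v (n div d)) / of_nat n powr s)"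
    using assms u1 v1 by (rule dirichlet_series_mult)
  also have "\<dots> = (\<Sum>\<^sub>\<infinity>n\<in>{1::nat}. 1)"
    by (rule infsum_cong_neutral) (use conv[of 1] in \<open>auto simp: conv\<close>)
  finally have prod: "?D u * ?D v = 1" by simp

  have "(\<lambda>n. u n / of_nat n powr s) summable_on {0<..}"
    using dirichlet_series_abs_summable[where u = u, OF assms u1] by (rule abs_summable_summable)
  hence "((\<lambda>n. u n / of_nat n powr s) has_sum ?D u) {0<..}" by (rule has_sum_infsum)
  hence "((\<lambda>n. u n / of_nat n powr s) has_sum ?D u) (range Suc)"
    by (metis greaterThan_0)
  hence "((\<lambda>n. u (Suc n) / of_nat (Suc n) powr s) has_sum ?D u) UNIV"
    by (subst (asm) has_sum_reindex) (simp_all add: o_def)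
  hence sums: "(\<lambda>n. of_int (mobius3 (Suc n)) / of_nat (Suc n) powr s) sums ?D u"
    unfolding u_def by (rule has_sum_imp_sums)

  have "(\<lambda>n. v n / of_nat n powr s) summable_on admissible"
    using dirichlet_series_abs_summable[where u = v, OF assms v1] by (rule abs_summable_summable)
  hence summ: "(\<lambda>n. (-1) ^ m_star n / of_nat n powr s) summable_on admissible"
    by (rule summable_on_cong[THEN iffD1, rotated]) (simp add: v_def)
  have Dv: "?D v = (\<Sum>\<^sub>\<infinity>n\<in>admissible. (-1) ^ m_star n / of_nat n powr s)"
    by (rule infsum_cong_neutral) (auto simp: v_def admissible_def)
  have "?D u \<noteq> 0" using prod by auto
  moreover have "inverse (?D u) = ?D v" using prod by (rule inverse_unique)
  ultimately show ?thesis
    using sums_summable[OF sums] sums_unique[OF sums, symmetric] summ Dv by simp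
qed

end
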